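(* For every integer $n\ge0$ let $$P_n=P_n(q)=\sum_{j\ge0}\sum_{k\ge0}(-1)^kq^{j^2+j+k}\begin{bmatrix} j+k\\ j\end{bmatrix}_{q^2}\begin{bmatrix} n-k\\ j\end{bmatrix}_{q^2}.$$ Then $$P_n=\sum_{j=-\infty}^\infty(-1)^jq^{j(5j+3)/2}\,T_1\!\left(n+1,\left\lfloor\tfrac{5j+2}{2}\right\rfloor;q\right),$$ and $P_0=1$, $P_1=q^2-q+1$, and $P_n=(1-q+q^{2n})P_{n-1}+qP_{n-2}$ for $n\ge2$.
   Context: $q$ is an indeterminate. $(a;p)_n=\prod_{i=0}^{n-1}(1-ap^i)$. The Gaussian polynomial in base $p$ is $\begin{bmatrix} A\\ B\end{bmatrix}_{p}=\frac{(p;p)_A}{(p;p)_B(p;p)_{A-B}}$ if $0\le B\le A$, and $0$ otherwise. For integers $L\ge0$ and $A$, $$T_1(L,A;q)=\sum_{r=0}^L(-q)^r\begin{bmatrix} L\\ r\end{bmatrix}_{q^2}\begin{bmatrix} 2L-2r\\ L-A-r\end{bmatrix}_{q}.$$ All sums have only finitely many nonzero terms. *)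

theory Defs
  imports
    "HOL-Computational_Algebra.Polynomial"
    "HOL-Computational_Algebra.Fraction_Field"
    "HOL-Library.Groups_Big_Fun"
begin

text \<open>
  All identities live in the field of rational functions in one indeterminate, so that the
  quotients defining Gaussian polynomials are genuine quotients (the indeterminate is not a
  root of unity, hence no denominator vanishes).
\<close>

type_synonym ratfun = "int poly fract"

definition indet :: ratfun where
  "indet = Fract [:0, 1:] 1"

definition qpoch :: "'a::field \<Rightarrow> 'a \<Rightarrow> nat \<Rightarrow> 'a" where
  "qpoch a p n = (\<Prod>i<n. 1 - a * p ^ i)"

text \<open>Integer arguments: the second clause covers negative entries as well.\<close>

definition gauss :: "int \<Rightarrow> int \<Rightarrow> 'a::field \<Rightarrow> 'a" where
  "gauss A B p =
     (if 0 \<le> B \<and> B \<le> A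
      then qpoch p p (nat A) / (qpoch p p (nat B) * qpoch p p (nat (A - B)))
      else 0)"

definition T1 :: "nat \<Rightarrow> int \<Rightarrow> 'a::field \<Rightarrow> 'a" where
  "T1 L A q = (\<Sum>r = 0..L. (- q) ^ r * gauss (int L) (int r) (q\<^sup>2)
                 * gauss (2 * int L - 2 * int r) (int L - A - int r) q)"

text \<open>
  \<^const>\<open>Sum_any\<close> is the sum over a whole type of a function with finite support (and 0 if the
  support is infinite); the lemmas below show that the supports in question are finite.
\<close>

definition P :: "nat \<Rightarrow> ratfun" where
  "P n = Sum_any (\<lambda>j::nat. Sum_any (\<lambda>k::nat.
           (- 1) ^ k * indet ^ (j\<^sup>2 + j + k)
             * gauss (int j + int k) (int j) (indet\<^sup>2)
             * gauss (int n - int k) (int j) (indet\<^sup>2)))"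

lemma finite_support_P_inner:
  "finite {k::nat. (- 1) ^ k * q ^ (j\<^sup>2 + j + k) * gauss (int j + int k) (int j) (q\<^sup>2)
             * gauss (int n - int k) (int j) (q\<^sup>2) \<noteq> (0::'a::field)}"
  by (rule finite_subset[of _ "{..n}"]) (auto simp: gauss_def split: if_splits)

lemma finite_support_P_outer:
  "finite {j::nat. Sum_any (\<lambda>k::nat. (- 1) ^ k * q ^ (j\<^sup>2 + j + k)
             * gauss (int j + int k) (int j) (q\<^sup>2)
             * gauss (int n - int k) (int j) (q\<^sup>2)) \<noteq> (0::'a::field)}"
proof (rule finite_subset[of _ "{..n}"])
  have "gauss (int n - int k) (int j) (q\<^sup>2) = 0" if "n < j" for j k
    using that by (auto simp: gauss_def)
  then show "{j::nat. Sum_any (\<lambda>k::nat. (- 1) ^ k * q ^ (j\<^sup>2 + j + k)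
             * gauss (int j + int k) (int j) (q\<^sup>2)
             * gauss (int n - int k) (int j) (q\<^sup>2)) \<noteq> (0::'a)} \<subseteq> {..n}"
    by (auto simp: not_less[symmetric])
qed auto

lemma T1_eq_0: "T1 L A q = 0" if "\<bar>A\<bar> > int L"
  unfolding T1_def using that by (intro sum.neutral) (auto simp: gauss_def)

lemma finite_support_T1_sum:
  "finite {j::int. (- 1) powi j * q powi e j * T1 L ((5 * j + 2) div 2) q \<noteq> (0::'a::field)}"
proof (rule finite_subset[of _ "{- int L - 1..int L + 1}"])
  have "T1 L ((5 * j + 2) div 2) q = 0" if "\<not> (- int L - 1 \<le> j \<and> j \<le> int L + 1)" for j
    using that by (intro T1_eq_0) linarith
  then show "{j::int. (- 1) powi j * q powi e j * T1 L ((5 * j + 2) div 2) q \<noteq> (0::'a)}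
               \<subseteq> {- int L - 1..int L + 1}"
    unfolding subset_iff mem_Collect_eq atLeastAtMost_iff by (metis mult_zero_right)
qed auto

lemma qpoch_indet_nonzero:
  assumes "m > 0"
  shows "qpoch (indet ^ m) (indet ^ m) n \<noteq> 0"
proof -
  have pow: "indet ^ k = Fract (monom 1 k) 1" for k
    by (induction k)
       (simp_all add: One_fract_def indet_def monom_Suc)
  have ne: "indet ^ k \<noteq> 1" if "k > 0" for k
  proof
    assume "indet ^ k = 1"
    then have "monom (1::int) k = 1"
      by (simp add: pow One_fract_def eq_fract)
    then have "degree (monom (1::int) k) = 0" by simp
    with that show False by (simp add: degree_monom_eq)
  qed
  have "indet ^ m * (indet ^ m) ^ i \<noteq> 1" for i
    using ne[of "m + m * i"] assms by (simp add: power_add power_mult)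
  then show ?thesis
    by (auto simp: qpoch_def)
qed

end

theory Submission
  imports Defs "HOL-Computational_Algebra.Formal_Power_Series"
begin

text \<open>
  Write \<open>[A, B]\<close> for a Gaussian polynomial and \<open>p = q\<^sup>2\<close>. Both sides of the identity turn out to
  satisfy the same recurrence of order two, and they agree at the start.

  For the double sum, the generating function of the inner sums over \<open>k\<close> is a product of two
  \<open>q\<close>-binomial series, so that
  \<open>\<Sum>\<^sub>n P n X^n = \<Sum>\<^sub>j q^(j\<^sup>2 + j) X^j / (\<Prod>i\<le>j. (1 - p^i X) (1 + q p^i X))\<close>.
  Splitting the factors with \<open>i = 0\<close> off every summand leaves the same series in \<open>p X\<close>, which is the
  functional equation \<open>P_functional_equation\<close>; its coefficients are the recurrence and the initial
  values.

  For the trinomial side, exchange the sum over \<open>j\<close> with the sum over \<open>r\<close> in the definition of \<^const>\<open>T1\<close>. The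
  sum over \<open>j\<close> becomes Schur's alternating sum for the finite Rogers-Ramanujan polynomials \<open>e M\<close>
  at the even index \<open>M = 2 (L - r)\<close>, and these satisfy \<open>e (M + 2) = e (M + 1) + q^(M + 1) e M\<close>
  (\<open>schur_recurrence\<close>). Eliminating the odd indices gives a recurrence for \<open>f N = e (2 N)\<close>. What remains is
  the transform \<open>f \<mapsto> (\<lambda>L. \<Sum>\<^sub>r (-q)^r [L, r] f (L - r))\<close> with Gaussian polynomials in base \<open>p\<close>. In terms
  of the series \<open>\<Sum>\<^sub>N f N x^N / (p; p)\<^sub>N\<close> it is multiplication by \<open>1 / (-q x; p)\<^sub>\<infinity>\<close>, so the operations "shift \<open>L\<close>"
  and "multiply by \<open>p^L\<close>" on its values come from operations on \<open>f\<close> that involve only neighbouring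
  arguments (\<open>qtrans_shift\<close>, \<open>qtrans_weight\<close>). With them the recurrence of \<open>f\<close> turns into the recurrence
  of \<open>P\<close> (\<open>qtrans_recurrence\<close>).
\<close>

section \<open>Gaussian polynomials\<close>

lemma qpoch_Suc: "qpoch p p (Suc n) = qpoch p p n * (1 - p ^ Suc n)"
  by (simp add: qpoch_def)

lemma gauss_outside: "B < 0 \<or> A < B \<Longrightarrow> gauss A B p = 0"
  by (auto simp: gauss_def)

lemma gauss_symmetric: "gauss A (A - B) p = gauss A B p"
  by (auto simp: gauss_def mult.commute)

lemma gauss_bottom_0:
  assumes "\<And>n. qpoch p p n \<noteq> 0" "A \<ge> 0"
  shows "gauss A 0 p = 1"
  using assms by (simp add: gauss_def qpoch_def)

lemma gauss_full:
  assumes "\<And>n. qpoch p p n \<noteq> 0" "A \<ge> 0"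
  shows "gauss A A p = 1"
  using gauss_bottom_0[OF assms] gauss_symmetric[of A 0 p] by simp

text \<open>
  The lower index is an arbitrary integer, so that the telescoping arguments below need no separate
  treatment of the ends of a summation range.
\<close>

lemma gauss_Pascal:
  fixes p :: "'a::field"
  assumes nz: "\<And>n. qpoch p p n \<noteq> 0" and A: "A \<ge> 0"
  shows "gauss (A + 1) B p = gauss A (B - 1) p + p powi B * gauss A B p"
proof -
  consider "B < 0" | "B = 0" | "B = A + 1" | "B > A + 1" | "1 \<le> B" "B \<le> A"
    by linarith
  then show ?thesis
  proof cases
    case 5
    define b d where "b = nat (B - 1)" and "d = nat (A - B)"
    have AB: "B = int (Suc b)" "A = int (Suc b + d)"
      using 5 by (auto simp: b_def d_def)
    have f: "1 - p ^ Suc n \<noteq> 0" for n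
      using nz[of "Suc n"] by (simp only: qpoch_Suc) simp
    have g: "gauss (int (m + n)) (int m) p = qpoch p p (m + n) / (qpoch p p m * qpoch p p n)" for m n
      by (simp add: gauss_def nat_add_distrib)
    have g1: "gauss (A + 1) B p
        = qpoch p p (Suc b + d) * (1 - p ^ (Suc b + Suc d))
            / (qpoch p p b * (1 - p ^ Suc b) * (qpoch p p d * (1 - p ^ Suc d)))"
      using g[of "Suc b" "Suc d"] unfolding AB by (simp add: qpoch_Suc add_ac)
    have g2: "gauss A (B - 1) p
        = qpoch p p (Suc b + d) / (qpoch p p b * (qpoch p p d * (1 - p ^ Suc d)))"
      using g[of b "Suc d"] unfolding AB by (simp add: qpoch_Suc add_ac)
    have g3: "gauss A B p = qpoch p p (Suc b + d) / (qpoch p p b * (1 - p ^ Suc b) * qpoch p p d)"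
      using g[of "Suc b" d] unfolding AB by (simp add: qpoch_Suc add_ac)
    have pB: "p powi B = p ^ Suc b"
      by (simp only: AB power_int_of_nat)
    have alg: "Q * (1 - x * y) / (u * (1 - x) * (v * (1 - y)))
        = Q / (u * (v * (1 - y))) + x * (Q / (u * (1 - x) * v))"
      if "u \<noteq> 0" "v \<noteq> 0" "1 - x \<noteq> 0" "1 - y \<noteq> 0" for Q x y u v :: 'a
      using that by (simp add: divide_simps) algebra
    show ?thesis
      unfolding g1 g2 g3 pB power_add
      by (rule alg) (use nz f in auto)
  qed (use A nz in \<open>auto simp: gauss_outside gauss_bottom_0 gauss_full\<close>)
qed

lemma gauss_Pascal':
  fixes p :: "'a::field"
  assumes nz: "\<And>n. qpoch p p n \<noteq> 0" and A: "A \<ge> 0"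
  shows "gauss (A + 1) B p = gauss A B p + p powi (A + 1 - B) * gauss A (B - 1) p"
  using gauss_Pascal[OF assms, of "A + 1 - B"] gauss_symmetric[of "A + 1" B p]
    gauss_symmetric[of A B p] gauss_symmetric[of A "B - 1" p]
  by (simp add: algebra_simps)

text \<open>
  The two Pascal rules expand the same Gaussian polynomial, so their right-hand sides agree.
\<close>

lemma gauss_absorb:
  fixes p :: "'a::field"
  assumes "\<And>n. qpoch p p n \<noteq> 0" "A \<ge> 0"
  shows "(1 - p powi (A + 1 - B)) * gauss A (B - 1) p = (1 - p powi B) * gauss A B p"
  using gauss_Pascal[OF assms, of B] gauss_Pascal'[OF assms, of B]
  by (simp add: algebra_simps)

section \<open>The generating function of the double sum\<close>

definition Ptop :: "nat \<Rightarrow> 'a::field \<Rightarrow> 'a fps" where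
  "Ptop j p = Abs_fps (\<lambda>m. gauss (int m) (int j) p)"

definition Pbot :: "nat \<Rightarrow> 'a \<Rightarrow> 'a::field \<Rightarrow> 'a fps" where
  "Pbot j z p = Abs_fps (\<lambda>k. z ^ k * gauss (int j + int k) (int j) p)"

definition dilate :: "'a::field \<Rightarrow> 'a fps \<Rightarrow> 'a fps" where
  "dilate p f = Abs_fps (\<lambda>n. p ^ n * fps_nth f n)"

lemma dilate_nth [simp]: "fps_nth (dilate p f) n = p ^ n * fps_nth f n"
  by (simp add: dilate_def)

lemma dilate_mult: "dilate p (f * g) = dilate p f * dilate p g"
proof (rule fps_ext)
  fix n
  have "p ^ n * (fps_nth f i * fps_nth g (n - i))
      = p ^ i * fps_nth f i * (p ^ (n - i) * fps_nth g (n - i))" if "i \<le> n" for i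
    using power_add[of p i "n - i"] that by simp
  then show "fps_nth (dilate p (f * g)) n = fps_nth (dilate p f * dilate p g) n"
    unfolding dilate_nth fps_mult_nth sum_distrib_left by (intro sum.cong) auto
qed

lemma dilate_sum: "dilate p (\<Sum>j\<in>J. f j) = (\<Sum>j\<in>J. dilate p (f j))"
  by (rule fps_ext) (simp add: fps_sum_nth sum_distrib_left)

text \<open>
  \<open>Ptop j p\<close> is the expansion of \<open>X^j / (\<Prod>i\<le>j. 1 - p^i X)\<close>. Splitting off the factor with \<open>i = 0\<close> is Pascal's rule
  in the form whose extra power of \<open>p\<close> depends on the exponent of \<open>X\<close>; that power is what rescales \<open>X\<close>.
\<close>

lemma Ptop_step:
  assumes nz: "\<And>n. qpoch p p n \<noteq> 0"
  shows "fps_const (p ^ j) * ((1 - fps_X) * Ptop (Suc j) p) = fps_X * dilate p (Ptop j p)"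
proof (rule fps_ext)
  fix m
  show "fps_nth (fps_const (p ^ j) * ((1 - fps_X) * Ptop (Suc j) p)) m
      = fps_nth (fps_X * dilate p (Ptop j p)) m"
  proof (cases m)
    case 0
    then show ?thesis by (simp add: Ptop_def gauss_outside)
  next
    case (Suc n)
    have "p ^ j * (p powi (int n - int j) * gauss (int n) (int j) p) = p ^ n * gauss (int n) (int j) p"
    proof (cases "j \<le> n")
      case True
      then have "p powi (int n - int j) = p ^ (n - j)"
        by (simp flip: of_nat_diff)
      then show ?thesis
        using power_add[of p j "n - j"] True by simp
    qed (simp add: gauss_outside)
    then show ?thesis
      using gauss_Pascal'[OF nz, of "int n" "int (Suc j)"]
      by (simp add: Suc Ptop_def left_diff_distrib add_ac)
  qed
qed

text \<open>
  The same for \<open>Pbot j z p\<close>, the expansion of \<open>1 / (\<Prod>i\<le>j. 1 - z p^i X)\<close>.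
\<close>

lemma Pbot_step:
  assumes nz: "\<And>n. qpoch p p n \<noteq> 0"
  shows "(1 - fps_const z * fps_X) * Pbot (Suc j) z p = dilate p (Pbot j z p)"
proof (rule fps_ext)
  fix m
  show "fps_nth ((1 - fps_const z * fps_X) * Pbot (Suc j) z p) m = fps_nth (dilate p (Pbot j z p)) m"
  proof (cases m)
    case 0
    then show ?thesis by (simp add: Pbot_def gauss_full[OF nz] left_diff_distrib mult.assoc)
  next
    case (Suc n)
    have "gauss (int (Suc j) + int (Suc n)) (int (Suc j)) p - gauss (int (Suc j) + int n) (int (Suc j)) p
        = p powi (int (Suc n)) * gauss (int j + int (Suc n)) (int j) p"
      using gauss_Pascal'[OF nz, of "int j + int n + 1" "int (Suc j)"]
      by (simp add: algebra_simps)
    then have "z ^ Suc n * (gauss (int (Suc j) + int (Suc n)) (int (Suc j)) p - gauss (int (Suc j) + int n) (int (Suc j)) p)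
        = p ^ Suc n * (z ^ Suc n * gauss (int j + int (Suc n)) (int j) p)"
      by (simp only: power_int_of_nat mult.left_commute)
    then show ?thesis
      by (simp add: Suc Pbot_def left_diff_distrib right_diff_distrib mult.assoc)
  qed
qed

definition Pterm :: "nat \<Rightarrow> 'a::field \<Rightarrow> 'a fps" where
  "Pterm j q = fps_const (q ^ (j\<^sup>2 + j)) * (Pbot j (- q) (q\<^sup>2) * Ptop j (q\<^sup>2))"

text \<open>
  The quotient of the prefactors \<open>q^(j\<^sup>2 + j)\<close> at \<open>j + 1\<close> and \<open>j\<close> is \<open>p * p^j\<close>. The factor \<open>p^j\<close> is used up by
  \<open>Ptop_step\<close>, and the other \<open>p\<close> turns \<open>X\<close> into \<open>p X\<close>.
\<close>

lemma Pterm_step: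
  fixes q :: "'a::field"
  assumes nz: "\<And>n. qpoch (q\<^sup>2) (q\<^sup>2) n \<noteq> 0"
  shows "(1 - fps_X) * (1 + fps_const q * fps_X) * Pterm (Suc j) q
           = dilate (q\<^sup>2) (fps_X * Pterm j q)"
proof -
  let ?p = "q\<^sup>2"
  let ?c = "fps_const (q ^ (j\<^sup>2 + j))"
  have e: "q ^ ((Suc j)\<^sup>2 + Suc j) = q ^ (j\<^sup>2 + j) * (?p * ?p ^ j)"
    by (simp add: power2_eq_square algebra_simps flip: power_add power_mult)
  have X: "dilate ?p fps_X = fps_const ?p * fps_X"
    by (rule fps_ext) (auto simp: fps_X_def)
  have C: "dilate ?p ?c = ?c"
    by (rule fps_ext) auto
  have "(1 - fps_X) * (1 + fps_const q * fps_X) * Pterm (Suc j) q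
      = ?c * fps_const ?p * (((1 - fps_const (- q) * fps_X) * Pbot (Suc j) (- q) ?p)
           * (fps_const (?p ^ j) * ((1 - fps_X) * Ptop (Suc j) ?p)))"
    unfolding Pterm_def e by (simp only: fps_const_mult[symmetric] fps_const_neg[symmetric]) algebra
  also have "\<dots> = ?c * fps_const ?p * (dilate ?p (Pbot j (- q) ?p) * (fps_X * dilate ?p (Ptop j ?p)))"
    by (simp only: Ptop_step[OF nz] Pbot_step[OF nz])
  also have "\<dots> = dilate ?p (fps_X * Pterm j q)"
    unfolding Pterm_def dilate_mult X C by (simp only: mult_ac)
  finally show ?thesis .
qed

lemma Pterm_0:
  fixes q :: "'a::field"
  assumes nz: "\<And>n. qpoch (q\<^sup>2) (q\<^sup>2) n \<noteq> 0"
  shows "(1 - fps_X) * (1 + fps_const q * fps_X) * Pterm 0 q = 1"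
proof -
  have "(1 - fps_X) * Ptop 0 (q\<^sup>2) = 1"
  proof (rule fps_ext)
    fix n show "fps_nth ((1 - fps_X) * Ptop 0 (q\<^sup>2)) n = fps_nth 1 n"
      by (cases n) (simp_all add: Ptop_def gauss_bottom_0[OF nz] left_diff_distrib)
  qed
  moreover have "(1 + fps_const q * fps_X) * Pbot 0 (- q) (q\<^sup>2) = 1"
  proof (rule fps_ext)
    fix n show "fps_nth ((1 + fps_const q * fps_X) * Pbot 0 (- q) (q\<^sup>2)) n = fps_nth 1 n"
      by (cases n) (simp_all add: Pbot_def gauss_bottom_0[OF nz] distrib_right mult.assoc)
  qed
  ultimately show ?thesis
    unfolding Pterm_def by (simp add: ac_simps)
qed

text \<open>
  The \<open>j\<close>-th series starts at \<open>X^j\<close>, so any partial sum up to \<open>N \<ge> n\<close> gives \<open>P n\<close>. The freedom in \<open>N\<close>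
  lets one finite sum serve for several coefficients at once.
\<close>

lemma P_eq_Pterm_sum:
  assumes "n \<le> N"
  shows "P n = fps_nth (\<Sum>j\<le>N. Pterm j indet) n"
proof -
  let ?p = "indet\<^sup>2"
  let ?g = "\<lambda>j k. (- 1) ^ k * indet ^ (j\<^sup>2 + j + k)
             * gauss (int j + int k) (int j) ?p * gauss (int n - int k) (int j) ?p"
  have inner: "Sum_any (?g j) = fps_nth (Pterm j indet) n" for j
  proof -
    have "Sum_any (?g j) = (\<Sum>k\<in>{0..n}. ?g j k)"
      by (rule Sum_any.expand_superset) (auto simp: gauss_def split: if_splits)
    also have "\<dots> = fps_nth (Pterm j indet) n"
      unfolding Pterm_def fps_mult_left_const_nth
      unfolding fps_mult_nth sum_distrib_left
      by (intro sum.cong refl)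
         (simp add: Pbot_def Ptop_def power_add of_nat_diff power_minus[of indet] mult_ac)
    finally show ?thesis .
  qed
  have van: "fps_nth (Pterm j indet) n = 0" if "j > n" for j
    unfolding Pterm_def using that
    by (auto simp: fps_mult_nth Ptop_def gauss_outside)
  have "P n = Sum_any (\<lambda>j. fps_nth (Pterm j indet) n)"
    unfolding P_def inner ..
  also have "\<dots> = (\<Sum>j\<le>N. fps_nth (Pterm j indet) n)"
    using van assms by (intro Sum_any.expand_superset) (auto simp: not_less[symmetric] intro: ccontr)
  finally show ?thesis by (simp add: fps_sum_nth)
qed

lemma indet_not_root_of_unity:
  "qpoch indet indet n \<noteq> 0" "qpoch (indet\<^sup>2) (indet\<^sup>2) n \<noteq> 0"
  using qpoch_indet_nonzero[of 1] qpoch_indet_nonzero[of 2] by simp_all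

text \<open>
  Summing \<open>Pterm_step\<close> over \<open>j\<close> reproduces the whole series, rescaled; \<open>Pterm_0\<close> contributes the \<open>1\<close>.
  A fixed coefficient only sees a partial sum, which avoids infinite sums of power series.
\<close>

lemma P_functional_equation:
  "(1 - fps_X) * (1 + fps_const indet * fps_X) * Abs_fps P
     = 1 + dilate (indet\<^sup>2) (fps_X * Abs_fps P)"
proof (rule fps_ext)
  fix n
  let ?K = "(1 - fps_X) * (1 + fps_const indet * fps_X)" and ?p = "indet\<^sup>2"
  let ?S = "\<lambda>N. \<Sum>j\<le>N. Pterm j indet"
  have trunc: "fps_nth (f * Abs_fps P) n = fps_nth (f * ?S N) n" if "n \<le> N" for f N
    unfolding fps_mult_nth
    using that by (intro sum.cong refl) (simp add: P_eq_Pterm_sum[of _ N])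
  have "?K * ?S (Suc n) = 1 + dilate ?p (fps_X * ?S n)"
    unfolding sum.atMost_Suc_shift distrib_left[of ?K] sum_distrib_left
    by (simp only: Pterm_0[OF indet_not_root_of_unity(2)]
        Pterm_step[OF indet_not_root_of_unity(2)] dilate_sum)
  then show "fps_nth (?K * Abs_fps P) n = fps_nth (1 + dilate ?p (fps_X * Abs_fps P)) n"
    using trunc[of "Suc n" ?K] trunc[of n fps_X] by simp
qed

lemma P_recurrence:
  shows "P 0 = 1"
    and "P 1 = indet\<^sup>2 - indet + 1"
    and "P (Suc (Suc n)) = (1 - indet + indet ^ (2 * Suc (Suc n))) * P (Suc n) + indet * P n"
proof -
  have expand: "(1 - fps_X) * (1 + fps_const indet * fps_X) * Abs_fps P
      = Abs_fps P - fps_const (1 - indet) * (fps_X * Abs_fps P)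
         - fps_const indet * (fps_X * (fps_X * Abs_fps P))"
    by (simp add: algebra_simps flip: fps_const_sub)
  note coeff = arg_cong[OF P_functional_equation[unfolded expand], of "\<lambda>f. fps_nth f m" for m]
  show P0: "P 0 = 1"
    using coeff[of 0] by simp
  show "P 1 = indet\<^sup>2 - indet + 1"
    using coeff[of 1] P0 by (simp add: algebra_simps)
  show "P (Suc (Suc n)) = (1 - indet + indet ^ (2 * Suc (Suc n))) * P (Suc n) + indet * P n"
    using coeff[of "Suc (Suc n)"] by (simp add: algebra_simps flip: power_mult power_add)
qed


section \<open>Schur's alternating sums\<close>

definition schur_term :: "nat \<Rightarrow> 'a::field \<Rightarrow> int \<Rightarrow> 'a" where
  "schur_term M q j = (- 1) powi j * q powi (j * (5 * j + 3) div 2)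
                        * gauss (int M) ((int M - 5 * j - 1) div 2) q"

definition schur :: "nat \<Rightarrow> 'a::field \<Rightarrow> 'a" where
  "schur M q = Sum_any (schur_term M q)"

lemma schur_term_support: "{j. schur_term M q j \<noteq> 0} \<subseteq> {- int M - 1..int M + 1}"
proof -
  have "schur_term M q j = 0" if "j < - int M - 1 \<or> j > int M + 1" for j
  proof -
    have "(int M - 5 * j - 1) div 2 < 0 \<or> int M < (int M - 5 * j - 1) div 2"
      using that by linarith
    then show ?thesis by (simp add: schur_term_def gauss_outside)
  qed
  then show ?thesis by (metis (mono_tags, lifting) atLeastAtMost_iff mem_Collect_eq not_le subsetI)
qed

lemma schur_0: "schur 0 q = 0"
proof -
  have "schur_term 0 q j = 0" for j :: int
  proof -
    have "(- 5 * j - 1) div 2 \<noteq> 0" by presburger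
    then have "(- 5 * j - 1) div 2 < 0 \<or> (- 5 * j - 1) div 2 > 0" by linarith
    then show ?thesis by (simp add: schur_term_def gauss_outside)
  qed
  then show ?thesis by (simp add: schur_def)
qed

lemma schur_1:
  assumes nz: "\<And>n. qpoch q q n \<noteq> 0"
  shows "schur 1 q = (1::'a::field)"
proof -
  have "schur_term 1 q j = (if j = 0 then 1 else 0)" for j
  proof (cases "j = 0")
    case False
    then have "(- (5 * j)) div 2 < 0 \<or> 1 < (- (5 * j)) div 2" by presburger
    then show ?thesis using False by (auto simp: schur_term_def gauss_outside)
  qed (simp add: schur_term_def gauss_bottom_0[OF nz])
  then show ?thesis by (simp add: schur_def)
qed

text \<open>
  A telescoping certificate for the recurrence. For \<open>j \<equiv> m + 1\<close> modulo 2 Pascal's rules collapse the three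
  Gaussian polynomials of the recurrence to a single term; for the other residue they give the same
  expression at \<open>j + 1\<close> with the opposite sign.
\<close>

definition schur_cert :: "nat \<Rightarrow> 'a::field \<Rightarrow> int \<Rightarrow> 'a" where
  "schur_cert m q j =
     (if even (int m + 1 - j)
      then (- 1) powi j * q powi (j * (5 * j + 3) div 2 + (int m + 1 - 5 * j) div 2)
             * gauss (int m) ((int m + 1 - 5 * j) div 2) q
      else 0)"

lemma schur_term_telescopes:
  fixes q :: "'a::field"
  assumes nz: "\<And>n. qpoch q q n \<noteq> 0" and q: "q \<noteq> 0"
  shows "schur_term (m + 2) q j - schur_term (m + 1) q j - q ^ (m + 1) * schur_term m q j
           = schur_cert m q j - schur_cert m q (j + 1)"
proof -
  define e where "e = j * (5 * j + 3) div 2"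
  have "even (j * (5 * j + 3))" by (cases "even j") auto
  then have e: "j * (5 * j + 3) = 2 * e" by (simp add: e_def)
  have qpow: "q ^ (m + 1) = q powi (int m + 1)"
    by (simp add: power_int_add q)
  show ?thesis
  proof (cases "even (int m + 1 - j)")
    case True
    define t where "t = (int m + 1 - 5 * j) div 2"
    have t: "int m + 1 - 5 * j = 2 * t" using True unfolding t_def by presburger
    have d: "(int (m + 2) - 5 * j - 1) div 2 = t" "(int (m + 1) - 5 * j - 1) div 2 = t - 1"
      "(int m - 5 * j - 1) div 2 = t - 1"
      using t by presburger+
    have "gauss (int (m + 2)) t q - gauss (int (m + 1)) (t - 1) q
            - q powi (int m + 1) * gauss (int m) (t - 1) q
        = q powi t * (gauss (int m) t q + q powi (int m + 1 - t) * gauss (int m) (t - 1) q)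
            - q powi (int m + 1) * gauss (int m) (t - 1) q"
      using gauss_Pascal[OF nz, of "int m + 1" t] gauss_Pascal'[OF nz, of "int m" t]
      by (simp add: add_ac)
    also have "\<dots> = q powi t * gauss (int m) t q"
      using q by (simp add: distrib_left flip: mult.assoc power_int_add)
    finally have "gauss (int (m + 2)) t q - gauss (int (m + 1)) (t - 1) q
            - q powi (int m + 1) * gauss (int m) (t - 1) q = q powi t * gauss (int m) t q" .
    then have "(- 1) powi j * q powi e * (gauss (int (m + 2)) t q - gauss (int (m + 1)) (t - 1) q
            - q powi (int m + 1) * gauss (int m) (t - 1) q)
        = (- 1) powi j * q powi e * (q powi t * gauss (int m) t q)"
      by simp
    moreover have "schur_cert m q j = (- 1) powi j * q powi e * (q powi t * gauss (int m) t q)"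
      using True q unfolding schur_cert_def e_def[symmetric] t_def[symmetric]
      by (simp add: power_int_add mult.assoc)
    moreover have "schur_cert m q (j + 1) = 0"
      using True unfolding schur_cert_def by (subst if_not_P) presburger+
    ultimately show ?thesis
      unfolding schur_term_def d e_def[symmetric] qpow by (simp add: algebra_simps)
  next
    case False
    define t where "t = (int m - 5 * j) div 2"
    have t: "int m - 5 * j = 2 * t" using False unfolding t_def by presburger
    have d: "(int (m + 2) - 5 * j - 1) div 2 = t" "(int (m + 1) - 5 * j - 1) div 2 = t"
      "(int m - 5 * j - 1) div 2 = t - 1"
      using t by presburger+
    have "gauss (int (m + 2)) t q - gauss (int (m + 1)) t q
            - q powi (int m + 1) * gauss (int m) (t - 1) q
        = q powi (int m + 2 - t) * (gauss (int m) (t - 2) q + q powi (t - 1) * gauss (int m) (t - 1) q)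
            - q powi (int m + 1) * gauss (int m) (t - 1) q"
      using gauss_Pascal'[OF nz, of "int m + 1" t] gauss_Pascal[OF nz, of "int m" "t - 1"]
      by (simp add: add_ac)
    also have "\<dots> = q powi (int m + 2 - t) * gauss (int m) (t - 2) q"
      using q by (simp add: distrib_left flip: mult.assoc power_int_add)
    finally have "gauss (int (m + 2)) t q - gauss (int (m + 1)) t q
            - q powi (int m + 1) * gauss (int m) (t - 1) q
            = q powi (int m + 2 - t) * gauss (int m) (t - 2) q" .
    then have "(- 1) powi j * q powi e * (gauss (int (m + 2)) t q - gauss (int (m + 1)) t q
            - q powi (int m + 1) * gauss (int m) (t - 1) q)
        = (- 1) powi j * q powi e * (q powi (int m + 2 - t) * gauss (int m) (t - 2) q)"
      by simp
    moreover have "schur_cert m q (j + 1)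
        = - ((- 1) powi j * q powi e * (q powi (int m + 2 - t) * gauss (int m) (t - 2) q))"
    proof -
      have ev: "even (int m + 1 - (j + 1))" using False by simp
      have i: "(int m + 1 - 5 * (j + 1)) div 2 = t - 2" using t by presburger
      have "(j + 1) * (5 * (j + 1) + 3) = 2 * (e + 5 * j + 4)"
        using e by (simp add: algebra_simps)
      then have "(j + 1) * (5 * (j + 1) + 3) div 2 = e + 5 * j + 4" by simp
      then have x: "(j + 1) * (5 * (j + 1) + 3) div 2 + (t - 2) = e + (int m + 2 - t)"
        using t by linarith
      show ?thesis
        unfolding schur_cert_def i x if_P[OF ev] using q by (simp add: power_int_add mult.assoc)
    qed
    moreover have "schur_cert m q j = 0"
      using False by (simp add: schur_cert_def)
    ultimately show ?thesis
      unfolding schur_term_def d e_def[symmetric] qpow by (simp add: algebra_simps)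
  qed
qed

lemma schur_recurrence:
  fixes q :: "'a::field"
  assumes "\<And>n. qpoch q q n \<noteq> 0" and "q \<noteq> 0"
  shows "schur (m + 2) q = schur (m + 1) q + q ^ (m + 1) * schur m q"
proof -
  define B where "B = int m + 3"
  have S: "schur n q = (\<Sum>j=- B..B. schur_term n q j)" if "n \<le> m + 2" for n
    unfolding schur_def using schur_term_support[of n q] that
    by (intro Sum_any.expand_superset) (auto simp: B_def)
  have ends: "schur_cert m q (- B) = 0" "schur_cert m q (B + 1) = 0"
    by (simp_all add: schur_cert_def B_def gauss_outside)
  have tele: "(\<Sum>j=a..a + int n. f j - f (j + 1)) = f a - f (a + int n + 1)" for f :: "int \<Rightarrow> 'a" and a n
  proof (induction n)
    case (Suc n)
    have "{a..a + int (Suc n)} = insert (a + int (Suc n)) {a..a + int n}" by auto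
    with Suc show ?case by (simp add: algebra_simps)
  qed simp
  have "schur (m + 2) q - schur (m + 1) q - q ^ (m + 1) * schur m q
      = (\<Sum>j=- B..B. schur_cert m q j - schur_cert m q (j + 1))"
    by (simp add: S sum_distrib_left flip: sum_subtractf schur_term_telescopes[OF assms])
  also have "\<dots> = 0"
    using tele[where a = "- B" and n = "nat (2 * B)" and f = "schur_cert m q"] ends by (simp add: B_def)
  finally show ?thesis by (simp add: algebra_simps)
qed

text \<open>
  Three consecutive instances of the recurrence eliminate the two odd indices.
\<close>

lemma schur_even_recurrence:
  fixes q :: "'a::field"
  assumes "\<And>n. qpoch q q n \<noteq> 0" and "q \<noteq> 0"
  shows "schur (2 * Suc (Suc N)) q = (1 + (1 + q) * q ^ (2 * N + 2)) * schur (2 * Suc N) q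
           - q ^ (4 * N + 3) * schur (2 * N) q"
  using schur_recurrence[OF assms, of "2 * N"] schur_recurrence[OF assms, of "2 * N + 1"]
    schur_recurrence[OF assms, of "2 * N + 2"]
  by (simp add: numeral_eq_Suc) (simp add: algebra_simps power_add mult_2_right mult_2)

section \<open>A q-binomial transform\<close>

definition qtrans :: "'a::field \<Rightarrow> (nat \<Rightarrow> 'a) \<Rightarrow> nat \<Rightarrow> 'a" where
  "qtrans q f L = (\<Sum>r\<le>L. (- q) ^ r * gauss (int L) (int r) (q\<^sup>2) * f (L - r))"

lemma qtrans_linear:
  "qtrans q (\<lambda>N. f N + g N) L = qtrans q f L + qtrans q g L"
  "qtrans q (\<lambda>N. c * f N) L = c * qtrans q f L"
  by (simp_all add: qtrans_def sum.distrib sum_distrib_left distrib_left mult.left_commute)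

text \<open>
  Pascal's rule for \<open>[L + 1, r]\<close>: the second summand, reindexed by \<open>r \<mapsto> r + 1\<close>, is the transform
  of \<open>f\<close> weighted by \<open>- q p^N\<close>. Hence \<open>f \<mapsto> (\<lambda>N. f (N + 1) - q p^N f N)\<close> corresponds to shifting \<open>L\<close>.
\<close>

lemma qtrans_shift:
  fixes q :: "'a::field"
  assumes nz: "\<And>n. qpoch (q\<^sup>2) (q\<^sup>2) n \<noteq> 0"
  shows "qtrans q (\<lambda>N. f (Suc N) - q * (q\<^sup>2) ^ N * f N) L = qtrans q f (Suc L)"
proof -
  let ?p = "q\<^sup>2"
  let ?h = "\<lambda>r. (- q) ^ r * gauss (int L) (int r) ?p * f (Suc L - r)"
  let ?k = "\<lambda>r. (- q) ^ r * (?p powi (int L + 1 - int r) * gauss (int L) (int r - 1) ?p) * f (Suc L - r)"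
  have "qtrans q f (Suc L) = (\<Sum>r\<le>Suc L. ?h r + ?k r)"
    unfolding qtrans_def
    using gauss_Pascal'[OF nz, of "int L"]
    by (intro sum.cong refl) (simp add: algebra_simps)
  also have "\<dots> = (\<Sum>r\<le>Suc L. ?h r) + (\<Sum>r\<le>Suc L. ?k r)"
    by (rule sum.distrib)
  also have "(\<Sum>r\<le>Suc L. ?h r) = (\<Sum>r\<le>L. ?h r)"
    by (simp add: gauss_outside)
  also have "(\<Sum>r\<le>Suc L. ?k r) = (\<Sum>r\<le>L. ?k (Suc r))"
    by (subst sum.atMost_Suc_shift) (simp add: gauss_outside)
  also have "(\<Sum>r\<le>L. ?h r) + (\<Sum>r\<le>L. ?k (Suc r))
      = qtrans q (\<lambda>N. f (Suc N) - q * ?p ^ N * f N) L"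
    unfolding qtrans_def sum.distrib[symmetric]
  proof (intro sum.cong refl)
    fix r assume "r \<in> {..L}"
    then have r: "r \<le> L" by simp
    then have "?p powi (int L + 1 - int (Suc r)) = ?p ^ (L - r)"
      by (simp flip: of_nat_diff)
    with r show "?h r + ?k (Suc r) = (- q) ^ r * gauss (int L) (int r) ?p
        * (f (Suc (L - r)) - q * ?p ^ (L - r) * f (L - r))"
      by (simp add: Suc_diff_le algebra_simps)
  qed
  finally show ?thesis ..
qed

text \<open>
  Absorption moves the factor \<open>1 - p^(L - r)\<close> to \<open>1 - p^(r + 1)\<close> at \<open>r + 1\<close>; after reindexing the second part
  equals \<open>- (1 - p^r)\<close> times the first one, and \<open>p^r p^(L - r) = p^L\<close> is left over. For \<open>N = 0\<close> the
  truncated argument \<open>N - 1\<close> is harmless because \<open>1 - p^N\<close> vanishes.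
\<close>

lemma qtrans_weight:
  fixes q :: "'a::field"
  assumes nz: "\<And>n. qpoch (q\<^sup>2) (q\<^sup>2) n \<noteq> 0"
  shows "qtrans q (\<lambda>N. (q\<^sup>2) ^ N * f N + q * (1 - (q\<^sup>2) ^ N) * (q\<^sup>2) ^ (N - 1) * f (N - 1)) L
           = (q\<^sup>2) ^ L * qtrans q f L"
proof -
  let ?p = "q\<^sup>2"
  let ?g = "\<lambda>r. (- q) ^ r * gauss (int L) (int r) ?p * ?p ^ (L - r) * f (L - r)"
  let ?h = "\<lambda>r. (1 - ?p ^ r) * ?g r"
  have step: "(- q) ^ r * gauss (int L) (int r) ?p
          * (q * (1 - ?p ^ (L - r)) * ?p ^ (L - r - 1) * f (L - r - 1)) = - ?h (Suc r)"
    if "r \<le> L" for r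
  proof -
    have "?p powi (int L + 1 - int (Suc r)) = ?p ^ (L - r)"
      using that by (simp flip: of_nat_diff)
    then have "(1 - ?p ^ (L - r)) * gauss (int L) (int r) ?p
        = (1 - ?p ^ Suc r) * gauss (int L) (int (Suc r)) ?p"
      using gauss_absorb[OF nz, of "int L" "int (Suc r)"] by (simp only: power_int_of_nat) simp
    then have "(- q) ^ r * q * ?p ^ (L - r - 1) * f (L - r - 1) * ((1 - ?p ^ (L - r)) * gauss (int L) (int r) ?p)
        = (- q) ^ r * q * ?p ^ (L - r - 1) * f (L - r - 1) * ((1 - ?p ^ Suc r) * gauss (int L) (int (Suc r)) ?p)"
      by simp
    then show ?thesis by (simp add: mult_ac)
  qed
  have "(\<Sum>r\<le>L. ?h (Suc r)) = (\<Sum>r\<le>Suc L. ?h r)"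
    by (subst sum.atMost_Suc_shift) simp
  also have "\<dots> = (\<Sum>r\<le>L. ?h r)"
    by (simp add: gauss_outside)
  finally have shift: "(\<Sum>r\<le>L. ?h (Suc r)) = (\<Sum>r\<le>L. ?h r)" .
  have "qtrans q (\<lambda>N. ?p ^ N * f N + q * (1 - ?p ^ N) * ?p ^ (N - 1) * f (N - 1)) L
      = (\<Sum>r\<le>L. ?g r + - ?h (Suc r))"
    unfolding qtrans_def
  proof (intro sum.cong refl)
    fix r assume "r \<in> {..L}"
    then show "(- q) ^ r * gauss (int L) (int r) ?p * (?p ^ (L - r) * f (L - r)
          + q * (1 - ?p ^ (L - r)) * ?p ^ (L - r - 1) * f (L - r - 1)) = ?g r + - ?h (Suc r)"
      using step[of r] by (simp only: distrib_left atMost_iff mult.assoc)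
  qed
  also have "\<dots> = (\<Sum>r\<le>L. ?g r - ?h r)"
    unfolding sum.distrib sum_negf shift sum_subtractf by simp
  also have "\<dots> = ?p ^ L * qtrans q f L"
    unfolding qtrans_def sum_distrib_left
  proof (intro sum.cong refl)
    fix r assume "r \<in> {..L}"
    then have "?p ^ L = ?p ^ r * ?p ^ (L - r)"
      by (simp flip: power_add)
    then show "?g r - ?h r = ?p ^ L * ((- q) ^ r * gauss (int L) (int r) ?p * f (L - r))"
      by (simp add: algebra_simps)
  qed
  finally show ?thesis .
qed

text \<open>
  Let \<open>h N = f (N + 1) - q p^N f N\<close>, the preimage of the shifted transform, and let \<open>R N = 0\<close> be the
  recurrence assumed for \<open>f\<close>. By the two preceding lemmas the recurrence claimed for the transform
  is the image of an equation of order three for \<open>f\<close>, and this equation is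
  \<open>R N + q (1 - p^N) R (N - 1) = 0\<close>.
\<close>

lemma qtrans_recurrence:
  fixes q :: "'a::field"
  assumes nz: "\<And>n. qpoch (q\<^sup>2) (q\<^sup>2) n \<noteq> 0"
    and rec: "\<And>N. f (Suc (Suc N)) = (1 + (1 + q) * q ^ (2 * N + 2)) * f (Suc N) - q ^ (4 * N + 3) * f N"
  shows "qtrans q f (Suc (Suc L))
           = (1 - q + q ^ (2 * (L + 1))) * qtrans q f (Suc L) + q * qtrans q f L"
proof -
  let ?p = "q\<^sup>2"
  define h where "h N = f (Suc N) - q * ?p ^ N * f N" for N
  have key: "h (Suc N) - q * ?p ^ N * h N
      = ((1 - q) * h N + ?p * (?p ^ N * h N + q * (1 - ?p ^ N) * ?p ^ (N - 1) * h (N - 1))) + q * f N" for N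
  proof (cases N)
    case 0
    have "f (Suc (Suc 0)) = (1 + (1 + q) * q\<^sup>2) * f (Suc 0) - q ^ 3 * f 0"
      using rec[of 0] by (simp add: numeral_eq_Suc)
    then show ?thesis
      by (simp add: 0 h_def algebra_simps power2_eq_square power3_eq_cube)
  next
    case (Suc K)
    define y where "y = ?p ^ K"
    have r0: "f (Suc (Suc K)) = (1 + (1 + q) * (q\<^sup>2 * y)) * f (Suc K) - q ^ 3 * y\<^sup>2 * f K"
    proof -
      have "q ^ (2 * K + 2) = q\<^sup>2 * y" "q ^ (4 * K + 3) = q ^ 3 * y\<^sup>2"
        by (simp_all add: y_def add_ac mult_ac flip: power_mult power_add)
      then show ?thesis using rec[of K] by simp
    qed
    have r1: "f (Suc (Suc (Suc K))) = (1 + (1 + q) * (q ^ 4 * y)) * f (Suc (Suc K)) - q ^ 7 * y\<^sup>2 * f (Suc K)"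
    proof -
      have "2 * Suc K + 2 = 4 + 2 * K" "4 * Suc K + 3 = 7 + 2 * K * 2" by simp_all
      then have "q ^ (2 * Suc K + 2) = q ^ 4 * y" "q ^ (4 * Suc K + 3) = q ^ 7 * y\<^sup>2"
        by (simp_all only: y_def power_add power_mult)
      then show ?thesis using rec[of "Suc K"] by simp
    qed
    have pw: "?p ^ Suc K = q\<^sup>2 * y" "?p ^ Suc (Suc K) = q ^ 4 * y"
      by (simp_all add: y_def power2_eq_square power4_eq_xxxx mult_ac)
    \<comment> \<open>Only \<open>f K\<close> and \<open>f (K + 1)\<close> survive the substitution, and their coefficients cancel.\<close>
    show ?thesis
      unfolding Suc h_def diff_Suc_1 pw y_def[symmetric] r1 r0
      by (simp add: algebra_simps eval_nat_numeral)
  qed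
  have h: "qtrans q h = (\<lambda>L. qtrans q f (Suc L))"
    using qtrans_shift[OF nz] by (simp add: h_def[abs_def] fun_eq_iff)
  have "qtrans q f (Suc (Suc L)) = qtrans q (\<lambda>N. h (Suc N) - q * ?p ^ N * h N) L"
    by (simp add: qtrans_shift[OF nz] h)
  also have "\<dots> = (1 - q) * qtrans q h L + ?p * (?p ^ L * qtrans q h L) + q * qtrans q f L"
    unfolding key qtrans_weight[OF nz, of h, symmetric] qtrans_linear ..
  finally show ?thesis
    by (simp add: h algebra_simps flip: power_mult power_add)
qed

section \<open>The trinomial sum and the theorem\<close>

text \<open>
  Because \<open>2 (L - r)\<close> is even, \<open>L - r - \<lfloor>(5 j + 2) / 2\<rfloor> = \<lfloor>(2 (L - r) - 5 j - 1) / 2\<rfloor>\<close>: the lower indices in \<^const>\<open>T1\<close>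
  are those of Schur's sum.
\<close>

lemma T1_sum_eq_qtrans:
  "Sum_any (\<lambda>j::int. (- 1) powi j * q powi (j * (5 * j + 3) div 2) * T1 L ((5 * j + 2) div 2) q)
     = qtrans q (\<lambda>N. schur (2 * N) q) L"
proof -
  define B where "B = {- 2 * int L - 1..2 * int L + 1}"
  let ?w = "\<lambda>j::int. (- 1) powi j * q powi (j * (5 * j + 3) div 2)"
  let ?t = "\<lambda>j::int. T1 L ((5 * j + 2) div 2) q"
  let ?c = "\<lambda>r. (- q) ^ r * gauss (int L) (int r) (q\<^sup>2)"
  have t0: "?t j = 0" if "j \<notin> B" for j
  proof (rule T1_eq_0)
    show "int L < \<bar>(5 * j + 2) div 2\<bar>"
      using that unfolding B_def atLeastAtMost_iff by linarith
  qed
  have s: "schur (2 * (L - r)) q = (\<Sum>j\<in>B. schur_term (2 * (L - r)) q j)" for r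
  proof -
    have "{- int (2 * (L - r)) - 1..int (2 * (L - r)) + 1} \<subseteq> B"
      by (auto simp: B_def)
    with schur_term_support[of "2 * (L - r)" q] show ?thesis
      unfolding schur_def by (intro Sum_any.expand_superset) (simp add: B_def, rule subset_trans)
  qed
  have "Sum_any (\<lambda>j. ?w j * ?t j) = (\<Sum>j\<in>B. ?w j * ?t j)"
    by (intro Sum_any.expand_superset) (simp add: B_def, use t0 in fastforce)
  also have "\<dots> = (\<Sum>j\<in>B. \<Sum>r\<le>L. ?c r * schur_term (2 * (L - r)) q j)"
  proof (intro sum.cong refl)
    fix j
    have "?w j * (?c r * gauss (2 * int L - 2 * int r) (int L - (5 * j + 2) div 2 - int r) q)
        = ?c r * schur_term (2 * (L - r)) q j" if "r \<le> L" for r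
    proof -
      have "(int (2 * (L - r)) - 5 * j - 1) div 2 = int L - (5 * j + 2) div 2 - int r"
        using that by (simp add: of_nat_diff)
      moreover have "int (2 * (L - r)) = 2 * int L - 2 * int r"
        using that by (simp add: of_nat_diff)
      ultimately show ?thesis by (simp only: schur_term_def mult_ac)
    qed
    then show "?w j * ?t j = (\<Sum>r\<le>L. ?c r * schur_term (2 * (L - r)) q j)"
      unfolding T1_def sum_distrib_left atLeast0AtMost by (intro sum.cong) auto
  qed
  also have "\<dots> = qtrans q (\<lambda>N. schur (2 * N) q) L"
    unfolding qtrans_def s sum_distrib_left by (rule sum.swap)
  finally show ?thesis .
qed

text \<open>
  The transform is evaluated at \<open>n + 1\<close>. Its value at \<open>0\<close> vanishes, so the recurrence also produces
  the value for \<open>n = 1\<close> from the one for \<open>n = 0\<close>.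
\<close>

lemma P_eq_qtrans: "P n = qtrans indet (\<lambda>N. schur (2 * N) indet) (Suc n)"
proof -
  let ?q = indet
  have q0: "?q \<noteq> 0"
    using qpoch_indet_nonzero[of 1 1] by (auto simp: indet_def eq_fract Zero_fract_def)
  define V where "V = qtrans ?q (\<lambda>N. schur (2 * N) ?q)"
  note nz = indet_not_root_of_unity
  have rec: "V (Suc (Suc L)) = (1 - ?q + ?q ^ (2 * (L + 1))) * V (Suc L) + ?q * V L" for L
    unfolding V_def
    by (intro qtrans_recurrence[OF nz(2)] schur_even_recurrence[OF nz(1) q0])
  have V0: "V 0 = 0"
    by (simp add: V_def qtrans_def schur_0)
  have "schur 2 ?q = 1"
    using schur_recurrence[OF nz(1) q0, of 0] schur_1[OF nz(1)]
    by (simp add: schur_0 flip: numeral_2_eq_2)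
  then have V1: "V 1 = 1"
    by (simp add: V_def qtrans_def schur_0 gauss_bottom_0[OF nz(2)])
  have "P n = V (Suc n) \<and> P (Suc n) = V (Suc (Suc n))"
  proof (induction n)
    case 0
    then show ?case
      using P_recurrence(1,2) rec[of 0] V0 V1 by (simp add: power2_eq_square)
  next
    case (Suc n)
    then show ?case
      using P_recurrence(3)[of n] rec[of "Suc n"] by simp
  qed
  then show ?thesis by (simp add: V_def)
qed

theorem mainTheorem6:
  shows "(\<forall>n::nat. P n =
            Sum_any (\<lambda>j::int. (- 1) powi j * indet powi (j * (5 * j + 3) div 2)
                                * T1 (n + 1) ((5 * j + 2) div 2) indet))
       \<and> P 0 = 1
       \<and> P 1 = indet\<^sup>2 - indet + 1
       \<and> (\<forall>n\<ge>2. P n = (1 - indet + indet ^ (2 * n)) * P (n - 1) + indet * P (n - 2))"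
proof (intro conjI allI impI)
  fix n :: nat
  show "P n = Sum_any (\<lambda>j::int. (- 1) powi j * indet powi (j * (5 * j + 3) div 2)
                                * T1 (n + 1) ((5 * j + 2) div 2) indet)"
    using P_eq_qtrans[of n] T1_sum_eq_qtrans[of indet "n + 1"] by simp
next
  fix n :: nat
  assume "n \<ge> 2"
  then obtain m where "n = Suc (Suc m)"
    by (metis add_2_eq_Suc le_Suc_ex)
  then show "P n = (1 - indet + indet ^ (2 * n)) * P (n - 1) + indet * P (n - 2)"
    using P_recurrence(3)[of m] by simp
qed (use P_recurrence(1,2) in auto)

end
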